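(* Let $0<q<1$, $0<a<q^{-1}$, $0<b<q^{-1}$, $c<0$ and $n,m\in\mathbb{N}$. Then for all $x$, $$\begin{aligned}P_{n+m}(x;a,b,c;q)=\sum_{k=0}^{\min(n,m)}&\frac{(q^{-n},q^{-m},abq^{2n+m+1},x,xb/c;q)_k}{(q,aq,cq,aq^{n+1},cq^{n+1};q)_k}(ac)^kq^{k^2+2k+nk}\\&\times P_{n-k}(xq^k;aq^k,bq^k,cq^k;q)\,P_{m-k}(xq^k;aq^{n+k},bq^{n+k},cq^{n+k};q).\end{aligned}$$
   Context: $\mathbb N=\{0,1,2,\dots\}$. $(y;q)_k=\prod_{j=0}^{k-1}(1-yq^j)$ and $(y_1,\dots,y_r;q)_k=\prod_i(y_i;q)_k$. The big $q$-Jacobi polynomials are $$P_n(x;a,b,c;q)=\sum_{j=0}^n\frac{(q^{-n},abq^{n+1},x;q)_j}{(aq,cq,q;q)_j}q^j.$$ *)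

theory Defs
  imports Complex_Main
begin

definition qpoch :: "'a::comm_ring_1 \<Rightarrow> 'a \<Rightarrow> nat \<Rightarrow> 'a" where
  "qpoch y q k = (\<Prod>j<k. 1 - y * q ^ j)"

definition qpochs :: "'a::comm_ring_1 list \<Rightarrow> 'a \<Rightarrow> nat \<Rightarrow> 'a" where
  "qpochs ys q k = (\<Prod>y\<leftarrow>ys. qpoch y q k)"

definition big_q_jacobi :: "nat \<Rightarrow> 'a::field \<Rightarrow> 'a \<Rightarrow> 'a \<Rightarrow> 'a \<Rightarrow> 'a \<Rightarrow> 'a" where
  "big_q_jacobi n x a b c q =
     (\<Sum>j=0..n. qpochs [q powi (- int n), a * b * q ^ (n + 1), x] q j
               / qpochs [a * q, c * q, q] q j * q ^ j)"

end

theory Submission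
  imports Defs
begin

text \<open>
  The formula is the \<open>q\<close>-Leibniz rule applied to the Rodrigues formula.  If \<open>w\<close> denotes the weight
  of the big \<open>q\<close>-Jacobi polynomials, then \<open>w(x;a,b,c) P\<^sub>n\<^sub>+\<^sub>m(x;a,b,c)\<close> is, up to a constant, the
  \<open>n\<close>-fold \<open>q\<close>-derivative of \<open>w(x;aq\<^sup>n,bq\<^sup>n,cq\<^sup>n) P\<^sub>m(x;aq\<^sup>n,bq\<^sup>n,cq\<^sup>n)\<close>.  Distributing the
  \<open>n\<close> derivatives over the two factors, \<open>k\<close> of them lower the degree of \<open>P\<^sub>m\<close> to \<open>m - k\<close>, while
  the remaining \<open>n - k\<close> turn the weight into a multiple of \<open>P\<^sub>n\<^sub>-\<^sub>k\<close>; the factor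
  \<open>(x,xb/c;q)\<^sub>k\<close> is a ratio of two weights.

  To avoid the infinite products in the weight, one derivative is taken at a time, by induction on
  \<open>n\<close>, with the weight divided out.  A single derivative is then the first-order operator
  \<open>f(x) \<mapsto> (x - aq)(x - cq) f(x) - aq\<^sup>2 (1 - x)(c - bx) f(qx)\<close>, which maps
  \<open>P\<^sub>n(x;aq,bq,cq)\<close> to a multiple of \<open>x P\<^sub>n\<^sub>+\<^sub>1(x;a,b,c)\<close> (lemma \<open>backward_shift\<close>).
  Applied to the \<open>k\<close>-th summand it yields, by the product rule, multiples of the summands \<open>k\<close>
  and \<open>k + 1\<close> for \<open>n + 1\<close> (lemma \<open>backward_shift_product_term\<close>): in one the degree of the first
  factor goes up, in the other the difference of the second factor is evaluated by
  \<open>forward_shift\<close>.  What is left is a Pascal-type recurrence for the coefficients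
  (\<open>product_coeff_recurrence\<close>).

  The operator produces a factor \<open>x\<close>, so the induction only gives the formula for \<open>x \<noteq> 0\<close>; since
  both sides are polynomials in \<open>x\<close>, the case \<open>x = 0\<close> follows by continuity.
\<close>

section \<open>q-shifted factorials\<close>

text \<open>
  For \<open>q \<noteq> 0\<close>, this says that none of the denominators \<open>(q,aq,cq;q)\<^sub>j\<close> vanishes.  It is stable
  under multiplying \<open>a\<close> and \<open>c\<close> by powers of \<open>q\<close>, which is what the induction needs and what
  inequalities such as \<open>a < 1/q\<close> would not express over a general field.
\<close>
definition admissible :: "'a::field \<Rightarrow> 'a \<Rightarrow> 'a \<Rightarrow> bool" where
  "admissible q a c \<longleftrightarrow> q \<noteq> 0 \<and> (\<forall>j>0. q ^ j \<noteq> 1 \<and> a * q ^ j \<noteq> 1 \<and> c * q ^ j \<noteq> 1)"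

lemma admissible_shift:
  assumes "admissible q a c"
  shows "admissible q (a * q ^ k) (c * q ^ k)"
  using assms unfolding admissible_def by (auto simp: mult.assoc simp flip: power_add)

lemma admissible_shift1:
  assumes "admissible q a c"
  shows "admissible q (a * q) (c * q)"
  using admissible_shift[OF assms, of 1] by simp

lemma qpoch_0 [simp]: "qpoch y q 0 = 1"
  by (simp add: qpoch_def)

lemma qpoch_Suc: "qpoch y q (Suc k) = qpoch y q k * (1 - y * q ^ k)"
  by (simp add: qpoch_def)

lemma qpoch_Suc_shift: "qpoch y q (Suc k) = (1 - y) * qpoch (y * q) q k"
  by (simp add: qpoch_def prod.lessThan_Suc_shift mult.assoc del: prod.lessThan_Suc)

lemma qpoch_nonzero:
  fixes y q :: "'a::field"
  assumes "\<And>j. j > 0 \<Longrightarrow> y * q ^ j \<noteq> 1"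
  shows "qpoch (y * q ^ Suc i) q k \<noteq> 0"
proof -
  have "y * q ^ Suc i * q ^ j \<noteq> 1" for j
    using assms[of "Suc i + j"] by (simp add: power_add mult.assoc)
  thus ?thesis by (auto simp: qpoch_def)
qed

lemma admissible_qpoch_nonzero:
  assumes "admissible q a c"
  shows "qpoch q q k \<noteq> 0 \<and> qpoch (a * q ^ Suc i) q k \<noteq> 0 \<and> qpoch (c * q ^ Suc i) q k \<noteq> 0"
  using qpoch_nonzero[of 1 q 0] qpoch_nonzero[of a q i] qpoch_nonzero[of c q i] assms
  by (auto simp: admissible_def)

lemma qpoch_inverse_power_eq_0:
  fixes q :: "'a::field"
  assumes "q \<noteq> 0" "n < k"
  shows "qpoch (inverse (q ^ n)) q k = 0"
  using assms by (auto simp: qpoch_def intro!: bexI[of _ n])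

section \<open>The forward and backward shift\<close>

definition jacobi_coeff :: "nat \<Rightarrow> 'a::field \<Rightarrow> 'a \<Rightarrow> 'a \<Rightarrow> 'a \<Rightarrow> nat \<Rightarrow> 'a" where
  "jacobi_coeff n a b c q j =
     qpoch (inverse (q ^ n)) q j * qpoch (a * b * q ^ (n + 1)) q j
       / (qpoch (a * q) q j * qpoch (c * q) q j * qpoch q q j)"

lemma jacobi_coeff_0 [simp]: "jacobi_coeff n a b c q 0 = 1"
  by (simp add: jacobi_coeff_def)

text \<open>
  The summation bound may be enlarged because \<open>(q\<^sup>-\<^sup>n;q)\<^sub>j\<close> vanishes for \<open>j > n\<close>.
\<close>
lemma big_q_jacobi_expand:
  fixes q :: "'a::field"
  assumes "q \<noteq> 0" "n \<le> N"
  shows "big_q_jacobi n x a b c q = (\<Sum>j\<le>N. jacobi_coeff n a b c q j * q ^ j * qpoch x q j)"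
proof -
  have "big_q_jacobi n x a b c q = (\<Sum>j\<le>n. jacobi_coeff n a b c q j * q ^ j * qpoch x q j)"
    unfolding big_q_jacobi_def atMost_atLeast0
    by (intro sum.cong) (auto simp: jacobi_coeff_def qpochs_def power_int_minus mult_ac)
  also have "\<dots> = (\<Sum>j\<le>N. jacobi_coeff n a b c q j * q ^ j * qpoch x q j)"
    using assms
    by (intro sum.mono_neutral_left) (auto simp: jacobi_coeff_def qpoch_inverse_power_eq_0)
  finally show ?thesis .
qed

lemma big_q_jacobi_0 [simp]: "big_q_jacobi 0 x a b c q = 1"
  by (simp add: big_q_jacobi_def qpochs_def)

text \<open>
  Since \<open>q (q\<^sup>-\<^sup>n - 1) = q\<^sup>1\<^sup>-\<^sup>n (1 - q\<^sup>n)\<close>, this is the constant of the classical forward shift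
  relation.  It is zero for \<open>n = 0\<close>, which makes the truncated degree \<open>n - 1\<close> in the lemma
  \<open>forward_shift\<close> harmless.
\<close>
definition forward_factor :: "nat \<Rightarrow> 'a::field \<Rightarrow> 'a \<Rightarrow> 'a \<Rightarrow> 'a \<Rightarrow> 'a" where
  "forward_factor n a b c q =
     q * (inverse (q ^ n) - 1) * (1 - a * b * q ^ (n + 1)) / ((1 - a * q) * (1 - c * q))"

lemma jacobi_coeff_forward:
  assumes "admissible q a c"
  shows "jacobi_coeff (Suc n) a b c q (Suc j) * (q ^ Suc j - 1) * q
    = forward_factor (Suc n) a b c q * jacobi_coeff n (a * q) (b * q) (c * q) q j"
proof -
  have q: "q \<noteq> 0" "q ^ Suc j \<noteq> 1" "a * q \<noteq> 1" "c * q \<noteq> 1"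
    using assms by (auto simp: admissible_def dest: spec[of _ 1])
  have e1: "qpoch (inverse (q ^ Suc n)) q (Suc j) =
      (1 - inverse (q ^ Suc n)) * qpoch (inverse (q ^ n)) q j"
    using q by (simp only: qpoch_Suc_shift) (simp add: field_simps)
  have e2: "qpoch (a * b * q ^ (Suc n + 1)) q (Suc j) =
      (1 - a * b * q ^ (Suc n + 1)) * qpoch (a * q * (b * q) * q ^ (n + 1)) q j"
    by (simp only: qpoch_Suc_shift) (simp add: mult_ac)
  have e3: "qpoch q q (Suc j) = qpoch q q j * (1 - q ^ Suc j)"
    by (simp add: qpoch_Suc)
  define u where "u = q ^ Suc j"
  have nz: "qpoch q q j \<noteq> 0" "qpoch (a * q * q) q j \<noteq> 0" "qpoch (c * q * q) q j \<noteq> 0"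
    using admissible_qpoch_nonzero[OF assms, of j 1] by (auto simp: mult.assoc)
  have q': "u \<noteq> 1" "1 - a * q \<noteq> 0" "1 - c * q \<noteq> 0" "1 - u \<noteq> 0" using q by (auto simp: u_def)
  show ?thesis
    unfolding jacobi_coeff_def forward_factor_def e1 e2 e3
      qpoch_Suc_shift[of "a * q"] qpoch_Suc_shift[of "c * q"] u_def[symmetric]
    using q' nz by (simp add: divide_simps) (simp add: algebra_simps)
qed

text \<open>
  Term by term: \<open>(x;q)\<^sub>j\<^sub>+\<^sub>1\<close> and \<open>(qx;q)\<^sub>j\<^sub>+\<^sub>1\<close> share the factor \<open>(qx;q)\<^sub>j\<close>, and their remaining
  factors \<open>1 - x\<close> and \<open>1 - xq\<^sup>j\<^sup>+\<^sup>1\<close> differ by \<open>x (q\<^sup>j\<^sup>+\<^sup>1 - 1)\<close>.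
\<close>
lemma forward_shift:
  assumes "admissible q a c"
  shows "big_q_jacobi n x a b c q - big_q_jacobi n (q * x) a b c q
    = forward_factor n a b c q * x * big_q_jacobi (n - 1) (q * x) (a * q) (b * q) (c * q) q"
proof (cases n)
  case 0
  thus ?thesis by (simp add: forward_factor_def)
next
  case (Suc m)
  have q: "q \<noteq> 0" using assms by (simp add: admissible_def)
  have *: "qpoch x q (Suc j) - qpoch (q * x) q (Suc j) = x * (q ^ Suc j - 1) * qpoch (q * x) q j" for j
  proof -
    have "qpoch x q (Suc j) = (1 - x) * qpoch (q * x) q j"
      by (simp add: qpoch_Suc_shift mult.commute)
    thus ?thesis by (simp add: qpoch_Suc algebra_simps)
  qed
  have "big_q_jacobi n x a b c q - big_q_jacobi n (q * x) a b c q
      = (\<Sum>j\<le>Suc m. jacobi_coeff n a b c q j * q ^ j * (qpoch x q j - qpoch (q * x) q j))"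
    unfolding big_q_jacobi_expand[OF q order_refl] Suc sum_subtractf[symmetric]
    by (intro sum.cong) (simp_all add: algebra_simps)
  also have "\<dots> = (\<Sum>j\<le>m. jacobi_coeff (Suc m) a b c q (Suc j) * (q ^ Suc j - 1) * q
                     * (x * q ^ j * qpoch (q * x) q j))"
    unfolding sum.atMost_Suc_shift by (simp add: * Suc mult_ac)
  also have "\<dots> = forward_factor n a b c q * x
      * (\<Sum>j\<le>m. jacobi_coeff m (a * q) (b * q) (c * q) q j * q ^ j * qpoch (q * x) q j)"
    unfolding jacobi_coeff_forward[OF assms] Suc
    by (simp add: sum_distrib_left mult_ac)
  finally show ?thesis
    by (simp add: Suc big_q_jacobi_expand[OF q, of m m])
qed

text \<open>
  After cancelling the common factors, with \<open>u = q\<^sup>j\<^sup>+\<^sup>1\<close>, \<open>v = q\<^sup>n\<^sup>+\<^sup>1\<close> and \<open>w = abq\<close>, this is the identity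
  \<open>(1 - u/v)(1 - wuv) - (1 - u)(1 - wu) = u (1 - 1/v)(1 - wv)\<close>.
\<close>
lemma jacobi_coeff_backward:
  assumes "admissible q a c"
  shows "jacobi_coeff n (a * q) (b * q) (c * q) q (Suc j) * (1 - a * q ^ (j + 2)) * (1 - c * q ^ (j + 2))
      - jacobi_coeff n (a * q) (b * q) (c * q) q j * (1 - a * b * q ^ (j + 2))
    = (1 - a * q) * (1 - c * q) * (jacobi_coeff (Suc n) a b c q (Suc j) * q ^ Suc j)"
proof -
  define u v where "u = q ^ Suc j" and "v = q ^ Suc n"
  define A C where "A = qpoch (a * q) q (Suc j)" and "C = qpoch (c * q) q (Suc j)"
  have q: "q \<noteq> 0" "u \<noteq> 1" "a * q \<noteq> 1" "c * q \<noteq> 1" "v \<noteq> 0" "1 - a * q \<noteq> 0" "1 - c * q \<noteq> 0" "1 - u \<noteq> 0"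
     and q2: "1 - a * q ^ (j + 2) \<noteq> 0"  "1 - c * q ^ (j + 2) \<noteq> 0"
    using assms by (auto simp: admissible_def u_def v_def dest: spec[of _ 1] simp del: power_Suc)
  have nz: "qpoch q q j \<noteq> 0" "A \<noteq> 0" "C \<noteq> 0"
    using admissible_qpoch_nonzero[OF assms, of j 0]
      admissible_qpoch_nonzero[OF assms, of "Suc j" 0] by (auto simp: A_def C_def)
  have A: "qpoch (a * q * q) q j = A / (1 - a * q)" "qpoch (c * q * q) q j = C / (1 - c * q)"
    using q by (simp_all add: A_def C_def qpoch_Suc_shift)
  have A': "qpoch (a * q * q) q (Suc j) = A * (1 - a * q ^ (j + 2)) / (1 - a * q)"
       "qpoch (c * q * q) q (Suc j) = C * (1 - c * q ^ (j + 2)) / (1 - c * q)"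
    using q unfolding qpoch_Suc A by (simp_all add: mult_ac)
  have e1: "qpoch (inverse (q ^ Suc n)) q (Suc j) = (1 - inverse v) * qpoch (inverse (q ^ n)) q j"
    using q by (simp only: qpoch_Suc_shift) (simp add: field_simps v_def)
  have e2: "qpoch (a * b * q ^ (Suc n + 1)) q (Suc j) =
      (1 - a * b * q * v) * qpoch (a * q * (b * q) * q ^ (n + 1)) q j"
    by (simp only: qpoch_Suc_shift) (simp add: mult_ac v_def)
  have e3: "qpoch q q (Suc j) = qpoch q q j * (1 - u)"
    by (simp add: qpoch_Suc u_def)
  have e4: "qpoch (inverse (q ^ n)) q (Suc j) = qpoch (inverse (q ^ n)) q j * (1 - u / v)"
    using q by (simp add: qpoch_Suc u_def v_def field_simps)
  have e5: "qpoch (a * q * (b * q) * q ^ (n + 1)) q (Suc j)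
     = qpoch (a * q * (b * q) * q ^ (n + 1)) q j * (1 - a * b * q * u * v)"
    by (simp add: qpoch_Suc u_def v_def mult_ac)
  have e6: "a * b * q ^ (j + 2) = a * b * q * u" by (simp add: u_def mult_ac)
  define s t where "s = 1 - a * q ^ (j + 2)" and "t = 1 - c * q ^ (j + 2)"
  define k l where "k = 1 - a * q" and "l = 1 - c * q"
  define X Y where "X = qpoch (inverse (q ^ n)) q j" and "Y = qpoch (a * q * (b * q) * q ^ (n + 1)) q j"
  define w where "w = a * b * q"
  have nz': "s \<noteq> 0" "t \<noteq> 0" "k \<noteq> 0" "l \<noteq> 0" using q q2 by (auto simp: s_def t_def k_def l_def)
  show ?thesis
    unfolding jacobi_coeff_def e1 e2 e3 e4 e5 e6 A' A
    unfolding A_def[symmetric] C_def[symmetric] u_def[symmetric] s_def[symmetric] t_def[symmetric]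
      k_def[symmetric] l_def[symmetric] X_def[symmetric] Y_def[symmetric] w_def[symmetric]
    using q nz nz' by (simp add: divide_simps) (simp add: algebra_simps)
qed

text \<open>
  On a basis element \<open>(x;q)\<^sub>j\<close> the operator yields \<open>x\<close> times a combination of \<open>(x;q)\<^sub>j\<close> and
  \<open>(x;q)\<^sub>j\<^sub>+\<^sub>1\<close>, so comparing coefficients leaves a two-term recurrence, namely
  \<open>jacobi_coeff_backward\<close>.
\<close>
lemma backward_shift:
  assumes "admissible q a c"
  shows "(x - a * q) * (x - c * q) * big_q_jacobi n x (a * q) (b * q) (c * q) q
      - a * q ^ 2 * (1 - x) * (c - b * x) * big_q_jacobi n (q * x) (a * q) (b * q) (c * q) q
    = (1 - a * q) * (1 - c * q) * x * big_q_jacobi (Suc n) x a b c q"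
proof -
  have q: "q \<noteq> 0" using assms by (simp add: admissible_def)
  define A where "A = jacobi_coeff n (a * q) (b * q) (c * q) q"
  define K where "K = (1 - a * q) * (1 - c * q)"
  have basis: "q ^ j * ((x - a * q) * (x - c * q) * qpoch x q j
        - a * q ^ 2 * (1 - x) * (c - b * x) * qpoch (q * x) q j)
      = x * ((1 - a * q ^ Suc j) * (1 - c * q ^ Suc j) * qpoch x q j
           - (1 - a * b * q ^ (j + 2)) * qpoch x q (Suc j))" for j
  proof -
    have "(1 - x) * qpoch (q * x) q j = qpoch x q j * (1 - x * q ^ j)"
      by (metis qpoch_Suc qpoch_Suc_shift mult.commute)
    hence *: "a * q ^ 2 * (1 - x) * (c - b * x) * qpoch (q * x) q j
      = a * q ^ 2 * (c - b * x) * (qpoch x q j * (1 - x * q ^ j))"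
      by (simp add: mult_ac)
    show ?thesis
      unfolding *
      by (simp add: qpoch_Suc algebra_simps power2_eq_square)
  qed
  have A_top: "A (Suc n) = 0"
    using q by (simp add: A_def jacobi_coeff_def qpoch_inverse_power_eq_0)
  have "(x - a * q) * (x - c * q) * big_q_jacobi n x (a * q) (b * q) (c * q) q
      - a * q ^ 2 * (1 - x) * (c - b * x) * big_q_jacobi n (q * x) (a * q) (b * q) (c * q) q
    = (\<Sum>j\<le>n. A j * (q ^ j * ((x - a * q) * (x - c * q) * qpoch x q j
        - a * q ^ 2 * (1 - x) * (c - b * x) * qpoch (q * x) q j)))"
    unfolding big_q_jacobi_expand[OF q order_refl] A_def sum_distrib_left sum_subtractf[symmetric]
    by (intro sum.cong) (simp_all add: algebra_simps)
  also have "\<dots> = x * ((\<Sum>j\<le>n. A j * (1 - a * q ^ Suc j) * (1 - c * q ^ Suc j) * qpoch x q j)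
      - (\<Sum>j\<le>n. A j * (1 - a * b * q ^ (j + 2)) * qpoch x q (Suc j)))"
    unfolding basis sum_distrib_left sum_subtractf[symmetric]
    by (intro sum.cong) (simp_all add: algebra_simps)
  also have "(\<Sum>j\<le>n. A j * (1 - a * q ^ Suc j) * (1 - c * q ^ Suc j) * qpoch x q j)
      = (\<Sum>j\<le>Suc n. A j * (1 - a * q ^ Suc j) * (1 - c * q ^ Suc j) * qpoch x q j)"
    by (simp add: A_top)
  also have "\<dots> = K + (\<Sum>j\<le>n. A (Suc j) * (1 - a * q ^ (j + 2)) * (1 - c * q ^ (j + 2)) * qpoch x q (Suc j))"
    unfolding sum.atMost_Suc_shift by (simp add: A_def K_def)
  also have "K + (\<Sum>j\<le>n. A (Suc j) * (1 - a * q ^ (j + 2)) * (1 - c * q ^ (j + 2)) * qpoch x q (Suc j))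
       - (\<Sum>j\<le>n. A j * (1 - a * b * q ^ (j + 2)) * qpoch x q (Suc j))
     = K + (\<Sum>j\<le>n. (A (Suc j) * (1 - a * q ^ (j + 2)) * (1 - c * q ^ (j + 2))
                  - A j * (1 - a * b * q ^ (j + 2))) * qpoch x q (Suc j))"
    by (simp only: sum_subtractf left_diff_distrib add_diff_eq)
  also have "\<dots> = K * (\<Sum>j\<le>Suc n. jacobi_coeff (Suc n) a b c q j * q ^ j * qpoch x q j)"
    unfolding A_def jacobi_coeff_backward[OF assms] sum.atMost_Suc_shift K_def
    by (simp add: sum_distrib_left distrib_left mult_ac)
  finally show ?thesis
    by (simp add: K_def big_q_jacobi_expand[OF q, of "Suc n" "Suc n"] mult_ac del: sum.atMost_Suc)
qed


section \<open>The coefficients of the product formula\<close>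

definition product_coeff :: "nat \<Rightarrow> nat \<Rightarrow> 'a::field \<Rightarrow> 'a \<Rightarrow> 'a \<Rightarrow> 'a \<Rightarrow> nat \<Rightarrow> 'a" where
  "product_coeff n m a b c q k =
     qpoch (inverse (q ^ n)) q k * qpoch (inverse (q ^ m)) q k
       * qpoch (a * b * q ^ (2 * n + m + 1)) q k
     / (qpoch q q k * qpoch (a * q) q k * qpoch (c * q) q k
       * qpoch (a * q ^ (n + 1)) q k * qpoch (c * q ^ (n + 1)) q k)
     * (a * c) ^ k * q ^ (k ^ 2 + 2 * k + n * k)"

lemma product_coeff_0 [simp]: "product_coeff n m a b c q 0 = 1"
  by (simp add: product_coeff_def)

lemma product_coeff_eq_0:
  assumes "q \<noteq> 0" "n < k \<or> m < k"
  shows "product_coeff n m a b c q k = 0"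
  using assms by (auto simp: product_coeff_def qpoch_inverse_power_eq_0)

text \<open>
  Up to common factors this is the \<open>q\<close>-Pascal rule in the form
  \<open>(q\<^sup>-\<^sup>n\<^sup>-\<^sup>1;q)\<^sub>k\<^sub>+\<^sub>1 = (q\<^sup>-\<^sup>n;q)\<^sub>k\<^sub>+\<^sub>1 + q\<^sup>-\<^sup>n\<^sup>-\<^sup>1 (q\<^sup>k\<^sup>+\<^sup>1 - 1) (q\<^sup>-\<^sup>n;q)\<^sub>k\<close>.  The proof writes every
  Pochhammer symbol in terms of the one of length \<open>k\<close> (length \<open>k + 1\<close> for the bases \<open>aq\<close> and
  \<open>cq\<close>) and every power in terms of \<open>q\<^sup>k\<^sup>+\<^sup>1\<close>, \<open>q\<^sup>n\<close>, \<open>q\<^sup>m\<close>, so that a rational identity in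
  independent unknowns remains.
\<close>
lemma product_coeff_recurrence:
  assumes "admissible q a c" "k < m"
  shows "(1 - a * q) * (1 - c * q) * product_coeff (Suc n) m a b c q (Suc k)
    = product_coeff n m (a * q) (b * q) (c * q) q (Suc k)
        * (inverse (q ^ Suc k) * (1 - a * q ^ (k + 2)) * (1 - c * q ^ (k + 2)))
      + product_coeff n m (a * q) (b * q) (c * q) q k
        * (a * c * q ^ (k + 2)
           * forward_factor (m - k) (a * q ^ (n + k + 1)) (b * q ^ (n + k + 1)) (c * q ^ (n + k + 1)) q)"
proof -
  define u v z where "u = q ^ Suc k" and "v = q ^ n" and "z = q ^ m"
  define A C where "A = qpoch (a * q) q (Suc k)" and "C = qpoch (c * q) q (Suc k)"
  define s t where "s = 1 - a * q ^ (k + 2)" and "t = 1 - c * q ^ (k + 2)"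
  define r l where "r = 1 - a * q" and "l = 1 - c * q"
  define A' C' where "A' = qpoch (a * q ^ (n + 2)) q k" and "C' = qpoch (c * q ^ (n + 2)) q k"
  define s' t' where "s' = 1 - a * q ^ (n + k + 2)" and "t' = 1 - c * q ^ (n + k + 2)"
  define X Y Z Q where "X = qpoch (inverse (q ^ n)) q k" and "Y = qpoch (inverse (q ^ m)) q k"
    and "Z = qpoch (a * b * q ^ (2 * n + m + 3)) q k" and "Q = qpoch q q k"
  define W where "W = 1 - a * b * q ^ (2 * n + m + 3 + k)"
  define p where "p = q ^ (k ^ 2 + 2 * k + n * k)"
  have q: "q \<noteq> 0" using assms by (simp add: admissible_def)
  have nz: "u \<noteq> 0" "v \<noteq> 0" "z \<noteq> 0" "1 - u \<noteq> 0" "s \<noteq> 0" "t \<noteq> 0" "r \<noteq> 0" "l \<noteq> 0" "s' \<noteq> 0" "t' \<noteq> 0"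
    using assms by (auto simp: admissible_def u_def v_def z_def s_def t_def r_def l_def s'_def t'_def
      dest: spec[of _ 1] simp del: power_Suc)
  have nz': "A \<noteq> 0" "C \<noteq> 0" "A' \<noteq> 0" "C' \<noteq> 0" "Q \<noteq> 0"
    using admissible_qpoch_nonzero[OF assms(1), of k 0]
      admissible_qpoch_nonzero[OF assms(1), of "Suc k" 0]
      admissible_qpoch_nonzero[OF assms(1), of k "Suc n"]
    by (auto simp: A_def C_def A'_def C'_def Q_def)
  have AC: "qpoch (a * q * q) q k = A / r" "qpoch (c * q * q) q k = C / l"
    using nz by (simp_all add: A_def C_def r_def l_def qpoch_Suc_shift)
  have AC_Suc: "qpoch (a * q * q) q (Suc k) = A * s / r" "qpoch (c * q * q) q (Suc k) = C * t / l"
    using nz unfolding qpoch_Suc AC by (simp_all add: s_def t_def mult_ac)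
  have AC': "qpoch (a * q * q ^ (n + 1)) q k = A'" "qpoch (c * q * q ^ (n + 1)) q k = C'"
    by (simp_all add: A'_def C'_def mult_ac)
  have AC'_Suc: "qpoch (a * q * q ^ (n + 1)) q (Suc k) = A' * s'"
      "qpoch (c * q * q ^ (n + 1)) q (Suc k) = C' * t'"
    unfolding qpoch_Suc AC' by (simp_all add: s'_def t'_def power_add mult_ac)
  have AC''_Suc: "qpoch (a * q ^ (Suc n + 1)) q (Suc k) = A' * s'"
      "qpoch (c * q ^ (Suc n + 1)) q (Suc k) = C' * t'"
    using AC'_Suc by (simp_all add: mult_ac)
  have X1: "qpoch (inverse (q ^ Suc n)) q (Suc k) = (1 - inverse (q * v)) * X"
    using q by (simp only: qpoch_Suc_shift) (simp add: field_simps v_def X_def)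
  have X2: "qpoch (inverse (q ^ n)) q (Suc k) = X * (1 - u / (q * v))"
    using q by (simp add: qpoch_Suc X_def u_def v_def field_simps)
  have Y: "qpoch (inverse (q ^ m)) q (Suc k) = Y * (1 - u / (q * z))"
    using q by (simp add: qpoch_Suc Y_def u_def z_def field_simps)
  have Z0: "qpoch (a * q * (b * q) * q ^ (2 * n + m + 1)) q k = Z"
    by (simp add: Z_def power_add numeral_3_eq_3 mult_ac)
  have Z1: "qpoch (a * b * q ^ (2 * Suc n + m + 1)) q (Suc k) = Z * W"
    by (simp add: qpoch_Suc Z_def W_def power_add numeral_3_eq_3 mult_ac)
  have Z2: "qpoch (a * q * (b * q) * q ^ (2 * n + m + 1)) q (Suc k) = Z * W"
    unfolding qpoch_Suc Z0 by (simp add: W_def power_add numeral_3_eq_3 mult_ac)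
  have Q: "qpoch q q (Suc k) = Q * (1 - u)"
    by (simp add: qpoch_Suc Q_def u_def)
  have Y': "inverse (q ^ (m - k)) = u / (q * z)"
    using q assms(2) by (simp add: u_def z_def power_diff field_simps)
  have W': "a * q ^ (n + k + 1) * (b * q ^ (n + k + 1)) * q ^ (m - k + 1) = a * b * q ^ (2 * n + m + 3 + k)"
  proof -
    have "(n + k + 1) + (n + k + 1) + (m - k + 1) = 2 * n + m + 3 + k"
      using assms(2) by simp
    thus ?thesis by (metis (no_types, lifting) mult.assoc mult.left_commute power_add)
  qed
  have ff: "forward_factor (m - k) (a * q ^ (n + k + 1)) (b * q ^ (n + k + 1)) (c * q ^ (n + k + 1)) q
      = q * (u / (q * z) - 1) * W / (s' * t')"
    unfolding forward_factor_def W' Y' by (simp add: W_def s'_def t'_def mult_ac)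
  have "(Suc k) ^ 2 + 2 * Suc k + Suc n * Suc k
      = (k ^ 2 + 2 * k + n * k) + Suc k + Suc k + Suc k + 1 + n"
    by (simp add: power2_eq_square algebra_simps)
  hence p1: "q ^ ((Suc k) ^ 2 + 2 * Suc k + Suc n * Suc k) = p * u * u * u * q * v"
    by (simp only: p_def u_def v_def power_add power_one_right)
  have "(Suc k) ^ 2 + 2 * Suc k + n * Suc k
      = (k ^ 2 + 2 * k + n * k) + Suc k + Suc k + 1 + n"
    by (simp add: power2_eq_square algebra_simps)
  hence p2: "q ^ ((Suc k) ^ 2 + 2 * Suc k + n * Suc k) = p * u * u * q * v"
    by (simp only: p_def u_def v_def power_add power_one_right)
  have ac: "(a * q * (c * q)) ^ Suc k = (a * c) ^ k * u * u * (a * c)"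
     "(a * q * (c * q)) ^ k = (a * c) ^ k * u * u / (q * q)"
    using q by (simp_all add: u_def power_mult_distrib mult_ac)
  have k2: "a * c * q ^ (k + 2) = a * c * q * u" by (simp add: u_def mult_ac)
  define w where "w = (a * c) ^ k"
  define ac where "ac = a * c"
  show ?thesis
    unfolding product_coeff_def ff p1 p2 ac X1 X2 Y Z0 Z1 Z2 Q AC AC' AC_Suc AC'_Suc AC''_Suc k2
      power_Suc[of "a * c"]
    unfolding A_def[symmetric] C_def[symmetric] X_def[symmetric] Y_def[symmetric] Q_def[symmetric]
      s_def[symmetric] t_def[symmetric] r_def[symmetric] l_def[symmetric] p_def[symmetric]
      w_def[symmetric] ac_def[symmetric] u_def[symmetric]
    using q nz nz' by (simp add: divide_simps) (simp add: algebra_simps)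
qed

section \<open>The product rule\<close>

definition product_term :: "nat \<Rightarrow> nat \<Rightarrow> 'a::field \<Rightarrow> 'a \<Rightarrow> 'a \<Rightarrow> 'a \<Rightarrow> 'a \<Rightarrow> nat \<Rightarrow> 'a" where
  "product_term n m x a b c q k =
     qpoch x q k * qpoch (x * b / c) q k
     * big_q_jacobi (n - k) (x * q ^ k) (a * q ^ k) (b * q ^ k) (c * q ^ k) q
     * big_q_jacobi (m - k) (x * q ^ k) (a * q ^ (n + k)) (b * q ^ (n + k)) (c * q ^ (n + k)) q"

text \<open>
  With \<open>y = xq\<^sup>k\<close>, write the \<open>k\<close>-th term as \<open>w(x) f(y) g(y)\<close>, where \<open>w(x) = (x,xb/c;q)\<^sub>k\<close>.
  Multiplication by \<open>q\<^sup>2\<^sup>k\<close> turns the coefficients of the operator for \<open>(a,b,c)\<close> at \<open>x\<close> into those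
  for \<open>(aq\<^sup>k,bq\<^sup>k,cq\<^sup>k)\<close> at \<open>y\<close>; this is the effect of \<open>w\<close> being a ratio of weights.  Replacing
  \<open>g(qy)\<close> by \<open>g(y) - (g(y) - g(qy))\<close> then splits the result: the operator acting on \<open>f\<close> gives the
  \<open>k\<close>-th term for \<open>n + 1\<close>, the difference of \<open>g\<close> gives the term \<open>k + 1\<close>.
\<close>
lemma backward_shift_product_term:
  assumes "admissible q a c" "c \<noteq> 0" "k \<le> n"
  shows "(x - a * q) * (x - c * q) * product_term n m x (a * q) (b * q) (c * q) q k
      - a * q ^ 2 * (1 - x) * (c - b * x) * product_term n m (q * x) (a * q) (b * q) (c * q) q k
    = x * (inverse (q ^ k) * (1 - a * q ^ (k + 1)) * (1 - c * q ^ (k + 1))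
             * product_term (Suc n) m x a b c q k
         + a * c * q ^ (k + 2)
           * forward_factor (m - k) (a * q ^ (n + k + 1)) (b * q ^ (n + k + 1)) (c * q ^ (n + k + 1)) q
           * product_term (Suc n) m x a b c q (Suc k))"
proof -
  define y A B C where "y = x * q ^ k" and "A = a * q ^ k" and "B = b * q ^ k" and "C = c * q ^ k"
  define f where "f = (\<lambda>y. big_q_jacobi (n - k) y (A * q) (B * q) (C * q) q)"
  define g where "g = (\<lambda>y. big_q_jacobi (m - k) y
      (a * q ^ (n + k + 1)) (b * q ^ (n + k + 1)) (c * q ^ (n + k + 1)) q)"
  define F where "F = forward_factor (m - k)
      (a * q ^ (n + k + 1)) (b * q ^ (n + k + 1)) (c * q ^ (n + k + 1)) q"
  define h where "h = big_q_jacobi (m - Suc k) (q * y)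
      (a * q ^ (n + k + 1) * q) (b * q ^ (n + k + 1) * q) (c * q ^ (n + k + 1) * q) q"
  define P where "P = big_q_jacobi (Suc n - k) y A B C q"
  define w where "w = qpoch x q k * qpoch (x * b / c) q k"
  define r where "r = q ^ k"
  have q: "q \<noteq> 0" "r \<noteq> 0" using assms by (auto simp: admissible_def r_def)
  have raise: "(y - A * q) * (y - C * q) * f y - A * q ^ 2 * (1 - y) * (C - B * y) * f (q * y)
      = (1 - A * q) * (1 - C * q) * y * P"
    using backward_shift[OF admissible_shift[OF assms(1), of k], of y "n - k" B] assms(3)
    by (simp add: A_def C_def f_def P_def Suc_diff_le)
  have split: "g (q * y) = g y - F * y * h"
    using forward_shift[OF admissible_shift[OF assms(1), of "n + k + 1"],
        of "m - k" y "b * q ^ (n + k + 1)"]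
    by (simp add: g_def F_def h_def algebra_simps)
  have w_Suc: "qpoch x q (Suc k) * qpoch (x * b / c) q (Suc k) = w * (1 - y) * (1 - y * b / c)"
    by (simp add: w_def qpoch_Suc y_def mult_ac)
  \<comment> \<open>The factor \<open>(1 - x)(1 - xb/c)\<close> of the operator extends \<open>w(qx)\<close> to the next Pochhammer symbol.\<close>
  have w_shift: "(1 - x) * (c - b * x) * (qpoch (q * x) q k * qpoch (q * x * b / c) q k)
      = c * (w * (1 - y) * (1 - y * b / c))"
  proof -
    have "(1 - x) * (c - b * x) * (qpoch (q * x) q k * qpoch (q * x * b / c) q k)
      = c * (((1 - x) * qpoch (x * q) q k) * ((1 - x * b / c) * qpoch (x * b / c * q) q k))"
      using assms(2) by (simp add: divide_simps mult_ac)
    thus ?thesis unfolding qpoch_Suc_shift[symmetric] w_Suc .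
  qed
  have T: "product_term n m x (a * q) (b * q) (c * q) q k = w * f y * g y"
    using q by (simp add: product_term_def w_def f_def g_def y_def A_def B_def C_def mult_ac)
  have Tq: "product_term n m (q * x) (a * q) (b * q) (c * q) q k
      = qpoch (q * x) q k * qpoch (q * x * b / c) q k * f (q * y) * g (q * y)"
    using q by (simp add: product_term_def f_def g_def y_def A_def B_def C_def mult_ac)
  have T0: "product_term (Suc n) m x a b c q k = w * P * g y"
    by (simp add: product_term_def w_def P_def g_def y_def A_def B_def C_def)
  have T1: "product_term (Suc n) m x a b c q (Suc k)
      = w * (1 - y) * (1 - y * b / c) * f (q * y) * h"
    unfolding product_term_def w_Suc
    by (simp add: f_def h_def y_def A_def B_def C_def mult_ac)
  have "r\<^sup>2 * ((x - a * q) * (x - c * q) * product_term n m x (a * q) (b * q) (c * q) q k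
      - a * q ^ 2 * (1 - x) * (c - b * x) * product_term n m (q * x) (a * q) (b * q) (c * q) q k)
    = r\<^sup>2 * ((x - a * q) * (x - c * q)) * (w * f y * g y)
      - r\<^sup>2 * a * q ^ 2 * ((1 - x) * (c - b * x) * (qpoch (q * x) q k * qpoch (q * x * b / c) q k))
        * f (q * y) * g (q * y)"
    unfolding T Tq by (simp add: algebra_simps)
  also have "\<dots> = (y - A * q) * (y - C * q) * (w * f y * g y)
      - A * q\<^sup>2 * (w * (1 - y) * (C - B * y)) * f (q * y) * g (q * y)"
    unfolding w_shift using assms(2)
    by (simp add: y_def A_def B_def C_def r_def power2_eq_square field_simps)
  also have "\<dots> = w * g y * ((y - A * q) * (y - C * q) * f y
          - A * q ^ 2 * (1 - y) * (C - B * y) * f (q * y))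
        + A * q\<^sup>2 * (w * (1 - y) * (C - B * y)) * f (q * y) * (F * y * h)"
    unfolding split by (simp add: algebra_simps)
  also have "\<dots> = (1 - A * q) * (1 - C * q) * y * (w * P * g y)
        + A * C * q\<^sup>2 * y * F * (w * (1 - y) * (1 - y * b / c) * f (q * y) * h)"
    unfolding raise using assms(2) by (simp add: B_def C_def field_simps)
  also have "\<dots> = r\<^sup>2 * (x * (inverse (q ^ k) * (1 - a * q ^ (k + 1)) * (1 - c * q ^ (k + 1))
             * product_term (Suc n) m x a b c q k
         + a * c * q ^ (k + 2) * F * product_term (Suc n) m x a b c q (Suc k)))"
    unfolding T0[symmetric] T1[symmetric] using q
    by (simp add: y_def A_def C_def power2_eq_square power_add r_def[symmetric] field_simps)
  finally show ?thesis using q by (simp add: F_def)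
qed

section \<open>The product formula\<close>

text \<open>
  The coefficients vanish for \<open>k > n\<close>, so the sum may run up to \<open>m\<close> instead of \<open>min n m\<close>; this keeps
  the index range fixed in the induction on \<open>n\<close>.
\<close>
lemma product_formula_nonzero:
  assumes "admissible q a c" "c \<noteq> 0" "x \<noteq> 0"
  shows "big_q_jacobi (n + m) x a b c q
    = (\<Sum>k\<le>m. product_coeff n m a b c q k * product_term n m x a b c q k)"
  using assms
proof (induction n arbitrary: a b c x)
  case 0
  have "(\<Sum>k\<le>m. product_coeff 0 m a b c q k * product_term 0 m x a b c q k)
      = (\<Sum>k\<in>{0}. product_coeff 0 m a b c q k * product_term 0 m x a b c q k)"
    using 0 by (intro sum.mono_neutral_right) (auto simp: admissible_def product_coeff_eq_0)
  thus ?case by (simp add: product_term_def)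
next
  case (Suc n)
  have q: "q \<noteq> 0" "1 - a * q \<noteq> 0" "1 - c * q \<noteq> 0"
    using Suc.prems(1) by (auto simp: admissible_def dest: spec[of _ 1])
  define K where "K = (1 - a * q) * (1 - c * q)"
  define L where "L = product_coeff n m (a * q) (b * q) (c * q) q"
  define T where "T = product_term (Suc n) m x a b c q"
  define \<alpha> where "\<alpha> k = inverse (q ^ k) * (1 - a * q ^ (k + 1)) * (1 - c * q ^ (k + 1))" for k
  define \<beta> where "\<beta> k = a * c * q ^ (k + 2) * forward_factor (m - k)
      (a * q ^ (n + k + 1)) (b * q ^ (n + k + 1)) (c * q ^ (n + k + 1)) q" for k
  have IH: "big_q_jacobi (n + m) y (a * q) (b * q) (c * q) q
      = (\<Sum>k\<le>m. L k * product_term n m y (a * q) (b * q) (c * q) q k)" if "y \<noteq> 0" for y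
    unfolding L_def using Suc.prems q that by (intro Suc.IH admissible_shift1) auto
  have "K * x * big_q_jacobi (Suc (n + m)) x a b c q
    = (x - a * q) * (x - c * q) * big_q_jacobi (n + m) x (a * q) (b * q) (c * q) q
      - a * q ^ 2 * (1 - x) * (c - b * x) * big_q_jacobi (n + m) (q * x) (a * q) (b * q) (c * q) q"
    unfolding K_def by (rule backward_shift[OF Suc.prems(1), symmetric])
  also have "\<dots> = (\<Sum>k\<le>m. L k *
      ((x - a * q) * (x - c * q) * product_term n m x (a * q) (b * q) (c * q) q k
       - a * q ^ 2 * (1 - x) * (c - b * x) * product_term n m (q * x) (a * q) (b * q) (c * q) q k))"
    using IH[of x] IH[of "q * x"] Suc.prems q
    by (simp add: sum_distrib_left sum_subtractf right_diff_distrib mult_ac)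
  also have "\<dots> = (\<Sum>k\<le>m. L k * (x * (\<alpha> k * T k + \<beta> k * T (Suc k))))"
  proof (intro sum.cong refl)
    fix k
    show "L k *
      ((x - a * q) * (x - c * q) * product_term n m x (a * q) (b * q) (c * q) q k
       - a * q ^ 2 * (1 - x) * (c - b * x) * product_term n m (q * x) (a * q) (b * q) (c * q) q k)
      = L k * (x * (\<alpha> k * T k + \<beta> k * T (Suc k)))"
    proof (cases "k \<le> n")
      case True
      show ?thesis
        unfolding backward_shift_product_term[OF Suc.prems(1,2) True] \<alpha>_def \<beta>_def T_def ..
    next
      \<comment> \<open>Here \<open>n - k\<close> is truncated and the product rule fails, but the coefficient is zero.\<close>
      case False
      thus ?thesis using q by (simp add: L_def product_coeff_eq_0)
    qed
  qed
  also have "\<dots> = x * ((\<Sum>k\<le>m. L k * \<alpha> k * T k) + (\<Sum>k\<le>m. L k * \<beta> k * T (Suc k)))"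
    by (simp add: sum_distrib_left sum.distrib distrib_left mult_ac)
  also have "(\<Sum>k\<le>m. L k * \<alpha> k * T k) = K * T 0 + (\<Sum>k<m. L (Suc k) * \<alpha> (Suc k) * T (Suc k))"
    unfolding lessThan_Suc_atMost[symmetric] sum.lessThan_Suc_shift
    by (simp add: L_def \<alpha>_def K_def)
  \<comment> \<open>The last summand drops out: a polynomial of degree 0 has zero difference, so \<open>\<beta> m = 0\<close>.\<close>
  also have "(\<Sum>k\<le>m. L k * \<beta> k * T (Suc k)) = (\<Sum>k<m. L k * \<beta> k * T (Suc k))"
    unfolding lessThan_Suc_atMost[symmetric] by (simp add: \<beta>_def forward_factor_def)
  also have "K * T 0 + (\<Sum>k<m. L (Suc k) * \<alpha> (Suc k) * T (Suc k)) + (\<Sum>k<m. L k * \<beta> k * T (Suc k))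
      = K * T 0 + (\<Sum>k<m. (L (Suc k) * \<alpha> (Suc k) + L k * \<beta> k) * T (Suc k))"
    by (simp add: sum.distrib distrib_right)
  also have "\<dots> = K * T 0 + (\<Sum>k<m. K * product_coeff (Suc n) m a b c q (Suc k) * T (Suc k))"
    using product_coeff_recurrence[OF Suc.prems(1), of _ m n b]
    by (simp add: L_def \<alpha>_def \<beta>_def K_def)
  also have "\<dots> = K * (\<Sum>k\<le>m. product_coeff (Suc n) m a b c q k * T k)"
    unfolding lessThan_Suc_atMost[symmetric] sum.lessThan_Suc_shift
    by (simp add: sum_distrib_left distrib_left mult.assoc)
  finally show ?case
    using Suc.prems(3) q by (simp add: T_def K_def)
qed

lemma continuous_qpoch [continuous_intros]:
  fixes q :: "'a::real_normed_field"
  assumes "continuous_on S f"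
  shows "continuous_on S (\<lambda>x. qpoch (f x) q k)"
  unfolding qpoch_def using assms by (intro continuous_intros)

lemma continuous_big_q_jacobi [continuous_intros]:
  fixes q :: "'a::real_normed_field"
  assumes "continuous_on S f" "q \<noteq> 0"
  shows "continuous_on S (\<lambda>x. big_q_jacobi n (f x) a b c q)"
  unfolding big_q_jacobi_expand[OF assms(2) order_refl]
  using assms(1) by (intro continuous_intros)

theorem product_formula:
  fixes q :: "'a::real_normed_field"
  assumes "admissible q a c" "c \<noteq> 0"
  shows "big_q_jacobi (n + m) x a b c q
    = (\<Sum>k\<le>m. product_coeff n m a b c q k * product_term n m x a b c q k)"
proof (cases "x = 0")
  case False
  thus ?thesis using assms by (intro product_formula_nonzero)
next
  case True
  define d where "d x = big_q_jacobi (n + m) x a b c q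
    - (\<Sum>k\<le>m. product_coeff n m a b c q k * product_term n m x a b c q k)" for x
  have "q \<noteq> 0" using assms by (simp add: admissible_def)
  hence "continuous_on UNIV d"
    unfolding d_def product_term_def using assms(2) by (intro continuous_intros) auto
  hence "d \<midarrow>0\<rightarrow> d 0"
    by (simp add: continuous_on_def)
  moreover have "d \<midarrow>0\<rightarrow> 0"
  proof (rule Lim_transform_eventually[OF tendsto_const])
    show "eventually (\<lambda>x. 0 = d x) (at 0)"
      using product_formula_nonzero[OF assms]
      by (auto simp: eventually_at_filter d_def)
  qed
  ultimately have "d 0 = 0" by (rule LIM_unique)
  thus ?thesis by (simp add: d_def True)
qed

lemma of_real_qpoch: "of_real (qpoch y q k) = qpoch (of_real y) (of_real q) k"
  by (simp add: qpoch_def)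

theorem mainTheorem11:
  fixes q a b c :: real and x :: complex and n m :: nat
  assumes "0 < q" and "q < 1"
    and "0 < a" and "a < inverse q"
    and "0 < b" and "b < inverse q"
    and "c < 0"
  shows "big_q_jacobi (n + m) x a b c q =
    (\<Sum>k=0..min n m.
        qpochs [complex_of_real (q powi (- int n)), complex_of_real (q powi (- int m)),
                complex_of_real (a * b * q ^ (2 * n + m + 1)), x, x * b / c] q k
      / qpochs [q, a * q, c * q,
                a * q ^ (n + 1), c * q ^ (n + 1)] q k
      * (a * c) ^ k * q ^ (k ^ 2 + 2 * k + n * k)
      * big_q_jacobi (n - k) (x * q ^ k) (a * q ^ k) (b * q ^ k) (c * q ^ k) q
      * big_q_jacobi (m - k) (x * q ^ k) (a * q ^ (n + k)) (b * q ^ (n + k)) (c * q ^ (n + k)) q)"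
proof -
  have le: "a * q ^ j < 1 \<and> q ^ j < 1" if "j > 0" for j
  proof -
    have "q ^ j \<le> q ^ 1" using assms that by (intro power_decreasing) auto
    moreover have "a * q < 1" using assms by (simp add: field_simps)
    moreover have "a * q ^ j \<le> a * q ^ 1" using assms calculation by (intro mult_left_mono) auto
    ultimately show ?thesis using assms by (simp only: power_one_right) linarith
  qed
  have "c * q ^ j \<noteq> 1" for j
    using assms mult_neg_pos[of c "q ^ j"] by auto
  with le have "admissible q a c"
    using assms(1) by (auto simp: admissible_def) (metis less_irrefl)+
  hence adm: "admissible (complex_of_real q) (complex_of_real a) (complex_of_real c)"
    unfolding admissible_def
    by (auto simp del: of_real_power of_real_mult simp flip: of_real_power of_real_mult)
  have "big_q_jacobi (n + m) x a b c q
    = (\<Sum>k\<le>m. product_coeff n m (complex_of_real a) b c q k * product_term n m x a b c q k)"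
    using assms by (intro product_formula adm) auto
  also have "\<dots> = (\<Sum>k=0..min n m. product_coeff n m (complex_of_real a) b c q k * product_term n m x a b c q k)"
    using assms by (intro sum.mono_neutral_right) (auto simp: product_coeff_eq_0)
  also have "\<dots> = (\<Sum>k=0..min n m.
        qpochs [complex_of_real (q powi (- int n)), complex_of_real (q powi (- int m)),
                complex_of_real (a * b * q ^ (2 * n + m + 1)), x, x * b / c] q k
      / qpochs [q, a * q, c * q,
                a * q ^ (n + 1), c * q ^ (n + 1)] q k
      * (a * c) ^ k * q ^ (k ^ 2 + 2 * k + n * k)
      * big_q_jacobi (n - k) (x * q ^ k) (a * q ^ k) (b * q ^ k) (c * q ^ k) q
      * big_q_jacobi (m - k) (x * q ^ k) (a * q ^ (n + k)) (b * q ^ (n + k)) (c * q ^ (n + k)) q)"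
    by (intro sum.cong refl)
       (simp add: product_coeff_def product_term_def qpochs_def of_real_qpoch power_int_minus mult_ac)
  finally show ?thesis .
qed

end
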